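(* Let $k$ be a rig and let $Z$ be an invertible, transitive $n\times n$ matrix over $k$. Let $i,j\in\{1,\ldots,n\}$. Then $$Z_{ij}=0\ \Longrightarrow\ (Z^{-1})_{ij}=0.$$
   Context: A rig is a set with a commutative monoid structure $(+,0)$ and a commutative monoid structure $(\cdot,1)$, the latter distributing over the former (including $0\cdot x=0$); additive inverses need not exist. $X_{ij}$ denotes the $(i,j)$-entry of a matrix $X$. An $n\times n$ matrix $Z$ over $k$ is invertible if it has a two-sided inverse $Z^{-1}$ among $n\times n$ matrices over $k$. An $n\times n$ matrix $Z$ over $k$ is transitive if for all $p\ge 0$ and $i_0,i_1,\ldots,i_p\in\{1,\ldots,n\}$, $$Z_{i_0i_p}=0\ \Longrightarrow\ Z_{i_0i_1}Z_{i_1i_2}\cdots Z_{i_{p-1}i_p}=0.$$ (An empty product is $1$, so the case $p=0$ states that $Z_{ii}=0$ implies $1=0$ in $k$.) *)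

theory Defs
  imports "Jordan_Normal_Form.Matrix"
begin

(* A rig is a commutative semiring with zero and one in which 0 = 1 is allowed; the library
   class comm_semiring_1 differs exactly by its additional axiom 0 ~= 1. *)
class rig = comm_semiring_0 + comm_monoid_mult

subclass (in comm_semiring_1) rig ..

(* The library's inverts_mat and invertible_mat require the class semiring_1, which has the
   axiom 0 ~= 1; the following notions make sense over every rig. *)
definition is_inverse_mat :: "nat \<Rightarrow> 'a::rig mat \<Rightarrow> 'a mat \<Rightarrow> bool" where
  "is_inverse_mat n Z W \<longleftrightarrow> W \<in> carrier_mat n n \<and> Z * W = 1\<^sub>m n \<and> W * Z = 1\<^sub>m n"

definition rig_invertible_mat :: "nat \<Rightarrow> 'a::rig mat \<Rightarrow> bool" where
  "rig_invertible_mat n Z \<longleftrightarrow> Z \<in> carrier_mat n n \<and> (\<exists>W. is_inverse_mat n Z W)"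

definition rig_inverse_mat :: "nat \<Rightarrow> 'a::rig mat \<Rightarrow> 'a mat" where
  "rig_inverse_mat n Z = (THE W. is_inverse_mat n Z W)"

(* Rows and columns of a matrix of type mat are numbered from 0, so the index set is {..<n}.
   Only the values i 0, ..., i p of the sequence i occur. *)
definition transitive_mat :: "nat \<Rightarrow> 'a::rig mat \<Rightarrow> bool" where
  "transitive_mat n Z \<longleftrightarrow>
     (\<forall>(p::nat) (i::nat \<Rightarrow> nat). (\<forall>m\<le>p. i m < n) \<longrightarrow>
        Z $$ (i 0, i p) = 0 \<longrightarrow> (\<Prod>m<p. Z $$ (i m, i (Suc m))) = 0)"

lemma rig_left_mult_one_mat:
  fixes A :: "'a::rig mat"
  assumes "A \<in> carrier_mat n m"
  shows "1\<^sub>m n * A = A"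
proof (rule eq_matI)
  fix i j assume ij: "i < dim_row A" "j < dim_col A"
  have "(1\<^sub>m n * A) $$ (i, j) = (\<Sum>l\<in>{0..<n}. (if i = l then 1 else 0) * A $$ (l, j))"
    using assms ij by (auto simp: scalar_prod_def intro!: sum.cong)
  also have "\<dots> = (\<Sum>l\<in>{0..<n}. if i = l then A $$ (l, j) else 0)"
    by (intro sum.cong) auto
  also have "\<dots> = A $$ (i, j)"
    using assms ij by simp
  finally show "(1\<^sub>m n * A) $$ (i, j) = A $$ (i, j)" .
qed (use assms in auto)

lemma rig_right_mult_one_mat:
  fixes A :: "'a::rig mat"
  assumes "A \<in> carrier_mat n m"
  shows "A * 1\<^sub>m m = A"
proof (rule eq_matI)
  fix i j assume ij: "i < dim_row A" "j < dim_col A"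
  have "(A * 1\<^sub>m m) $$ (i, j) = (\<Sum>l\<in>{0..<m}. A $$ (i, l) * (if l = j then 1 else 0))"
    using assms ij by (auto simp: scalar_prod_def intro!: sum.cong)
  also have "\<dots> = (\<Sum>l\<in>{0..<m}. if l = j then A $$ (i, l) else 0)"
    by (intro sum.cong) auto
  also have "\<dots> = A $$ (i, j)"
    using assms ij by simp
  finally show "(A * 1\<^sub>m m) $$ (i, j) = A $$ (i, j)" .
qed (use assms in auto)

lemma is_inverse_mat_unique:
  assumes Z: "Z \<in> carrier_mat n n" and V: "is_inverse_mat n Z V" and W: "is_inverse_mat n Z W"
  shows "V = W"
proof -
  have car: "V \<in> carrier_mat n n" "W \<in> carrier_mat n n"
    using V W by (auto simp: is_inverse_mat_def)
  have "V = V * (Z * W)"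
    using W rig_right_mult_one_mat[OF car(1)] by (simp add: is_inverse_mat_def)
  also have "\<dots> = (V * Z) * W"
    using assoc_mult_mat[OF car(1) Z car(2)] by simp
  also have "\<dots> = W"
    using V rig_left_mult_one_mat[OF car(2)] by (simp add: is_inverse_mat_def)
  finally show ?thesis .
qed

lemma is_inverse_rig_inverse_mat:
  assumes "rig_invertible_mat n Z"
  shows "is_inverse_mat n Z (rig_inverse_mat n Z)"
proof -
  have "\<exists>!W. is_inverse_mat n Z W"
    using assms is_inverse_mat_unique unfolding rig_invertible_mat_def by blast
  then show ?thesis
    unfolding rig_inverse_mat_def by (rule theI')
qed

end

theory Submission
  imports Defs "HOL-Combinatorics.Orbits"
begin

text \<open>
  Write \<open>W\<close> for the inverse of \<open>Z\<close>. Over a field, Cramer's rule says that \<open>W\<^sub>i\<^sub>j det Z\<close> is the determinant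
  of the matrix \<open>M\<close> obtained from \<open>Z\<close> by replacing column \<open>i\<close> with the unit vector \<open>e\<^sub>j\<close>. A permutation
  contributing to \<open>det M\<close> sends \<open>j\<close> to \<open>i\<close>, so its cycle through \<open>j\<close> returns from \<open>i\<close> to \<open>j\<close> along
  entries of \<open>Z\<close>. If \<open>Z\<^sub>i\<^sub>j = 0\<close>, transitivity kills the product along that path, hence every term of
  the expansion of \<open>det M\<close> (\<open>cramer_term_eq_0\<close>), and not merely their signed sum.

  Over a rig there are no signs, but the sums over the even and over the odd permutations can be
  treated separately. Expand either of them for a product \<open>W M\<close> as a sum over maps \<open>f\<close> choosing a
  row of \<open>M\<close> for each row of \<open>W\<close>. A map \<open>f\<close> that is not injective repeats a row and contributes
  equally to both sums; an injective \<open>f\<close> contributes terms of the expansion of \<open>det M\<close>. If all the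
  latter vanish, the two sums for \<open>W M\<close> agree (\<open>half_det_mult_eq\<close>), which replaces
  \<open>det (W M) = det W det M = 0\<close> and never divides by a determinant.

  Here \<open>W M\<close> is the identity matrix with column \<open>i\<close> replaced by column \<open>j\<close> of \<open>W\<close>. Its even sum is
  \<open>W\<^sub>i\<^sub>j\<close>, from the identity permutation, and its odd sum is \<open>0\<close>. So \<open>W\<^sub>i\<^sub>j = 0\<close>.
\<close>

section \<open>Products and sums over a rig\<close>

lemma rig_prod_zero:
  fixes f :: "'a \<Rightarrow> 'k::rig"
  assumes "finite A" "a \<in> A" "f a = 0"
  shows "prod f A = 0"
  using assms by (simp add: prod.remove)

text \<open>The analogue of \<open>prod_sum_PiE\<close>, whose type class has the axiom \<open>0 \<noteq> 1\<close>.\<close>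

lemma rig_prod_sum_PiE:
  fixes f :: "'a \<Rightarrow> 'b \<Rightarrow> 'k::rig"
  assumes "finite A"
  shows "(\<Prod>x\<in>A. \<Sum>y\<in>B. f x y) = (\<Sum>g\<in>A \<rightarrow>\<^sub>E B. \<Prod>x\<in>A. f x (g x))"
  using assms
proof (induction A)
  case empty
  then show ?case by simp
next
  case (insert a A)
  have "(\<Sum>g\<in>insert a A \<rightarrow>\<^sub>E B. \<Prod>x\<in>insert a A. f x (g x)) =
      (\<Sum>(y, g)\<in>B \<times> (A \<rightarrow>\<^sub>E B). \<Prod>x\<in>insert a A. f x ((g(a := y)) x))"
    unfolding PiE_insert_eq
    by (subst sum.reindex[OF inj_combinator[OF insert.hyps(2)]])
      (simp add: case_prod_beta comp_def)
  also have "\<dots> = (\<Sum>(y, g)\<in>B \<times> (A \<rightarrow>\<^sub>E B). f a y * (\<Prod>x\<in>A. f x (g x)))"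
  proof (intro sum.cong refl, clarify)
    fix y g
    have "(\<Prod>x\<in>A. f x ((g(a := y)) x)) = (\<Prod>x\<in>A. f x (g x))"
      using insert.hyps by (intro prod.cong) auto
    then show "(\<Prod>x\<in>insert a A. f x ((g(a := y)) x)) = f a y * (\<Prod>x\<in>A. f x (g x))"
      using insert.hyps by simp
  qed
  also have "\<dots> = (\<Sum>y\<in>B. f a y) * (\<Sum>g\<in>A \<rightarrow>\<^sub>E B. \<Prod>x\<in>A. f x (g x))"
    by (simp add: sum_product sum.cartesian_product)
  finally show ?case
    using insert by simp
qed

section \<open>Even and odd halves of the determinant\<close>

text \<open>For \<open>b = True\<close> and \<open>b = False\<close> these are the two sums whose difference is the determinant over
  a commutative ring.\<close>

definition half_det :: "bool \<Rightarrow> 'a set \<Rightarrow> ('a \<Rightarrow> 'a \<Rightarrow> 'k::rig) \<Rightarrow> 'k" where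
  "half_det b S A = (\<Sum>p | p permutes S \<and> evenperm p = b. \<Prod>k\<in>S. A k (p k))"

text \<open>Composing with the transposition of the two equal rows matches even permutations with odd ones
  without changing the product.\<close>

lemma half_det_equal_rows:
  fixes A :: "'a \<Rightarrow> 'a \<Rightarrow> 'k::rig"
  assumes fin: "finite S" and xy: "x \<in> S" "y \<in> S" "x \<noteq> y" and eq: "A x = A y"
  shows "half_det True S A = half_det False S A"
  unfolding half_det_def
proof (rule sum.reindex_bij_witness[where i = "\<lambda>p. p \<circ> transpose x y"
      and j = "\<lambda>p. p \<circ> transpose x y"])
  have t: "transpose x y permutes S"
    using xy by (simp add: permutes_swap_id)
  have step: "p \<circ> transpose x y permutes S" "evenperm (p \<circ> transpose x y) \<longleftrightarrow> \<not> evenperm p"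
    if "p permutes S" for p
  proof -
    show "p \<circ> transpose x y permutes S"
      by (rule permutes_compose[OF t that])
    have "permutation p"
      using that fin by (auto simp: permutation_permutes)
    then show "evenperm (p \<circ> transpose x y) \<longleftrightarrow> \<not> evenperm p"
      using xy by (simp add: evenperm_comp permutation_swap_id evenperm_swap)
  qed
  fix p :: "'a \<Rightarrow> 'a"
  show "(p \<circ> transpose x y) \<circ> transpose x y = p"
    by (simp add: comp_assoc)
  then show "(p \<circ> transpose x y) \<circ> transpose x y = p" .
  show "p \<circ> transpose x y \<in> {p. p permutes S \<and> evenperm p = True}"
    if "p \<in> {p. p permutes S \<and> evenperm p = False}"
    using that step by auto
  show "p \<circ> transpose x y \<in> {p. p permutes S \<and> evenperm p = False}"
    if "p \<in> {p. p permutes S \<and> evenperm p = True}"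
    using that step by auto
  have "A (transpose x y k) = A k" for k
    using eq by (auto simp: transpose_def)
  then have "(\<lambda>k. A k (p k)) \<circ> transpose x y = (\<lambda>k. A k ((p \<circ> transpose x y) k))"
    by (simp add: fun_eq_iff)
  then show "(\<Prod>k\<in>S. A k ((p \<circ> transpose x y) k)) = (\<Prod>k\<in>S. A k (p k))"
    using prod.permute[OF t, of "\<lambda>k. A k (p k)"] by simp
qed

lemma half_det_permuted_rows_eq_0:
  fixes A :: "'a \<Rightarrow> 'a \<Rightarrow> 'k::rig"
  assumes fin: "finite S" and inj: "inj_on f S" and f: "f ` S \<subseteq> S"
    and zero: "\<And>p. p permutes S \<Longrightarrow> (\<Prod>k\<in>S. A k (p k)) = 0"
  shows "half_det b S (\<lambda>k. A (f k)) = 0"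
proof -
  define g where "g = (\<lambda>x. if x \<in> S then f x else x)"
  have "bij_betw g S S"
    unfolding bij_betw_def using inj f endo_inj_surj[OF fin f inj]
    by (auto simp: g_def inj_on_def)
  then have g: "g permutes S"
    by (rule bij_imp_permutes) (simp add: g_def)
  have "(\<Prod>k\<in>S. A (f k) (p k)) = 0" if p: "p permutes S" for p
  proof -
    have "(\<Prod>k\<in>S. A (f k) (p k)) = (\<Prod>k\<in>S. A (g k) (p k))"
      by (rule prod.cong) (auto simp: g_def)
    also have "\<dots> = (\<Prod>k\<in>S. A k ((p \<circ> inv_into UNIV g) k))"
      by (subst prod.permute[OF permutes_inv[OF g]]) (simp add: comp_def permutes_inverses[OF g])
    also have "\<dots> = 0"
      by (intro zero permutes_compose permutes_inv g p)
    finally show ?thesis .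
  qed
  then show ?thesis
    by (simp add: half_det_def)
qed

lemma half_det_mult:
  fixes A B :: "'a \<Rightarrow> 'a \<Rightarrow> 'k::rig"
  assumes fin: "finite S"
  shows "half_det b S (\<lambda>k c. \<Sum>l\<in>S. A k l * B l c) =
    (\<Sum>f\<in>S \<rightarrow>\<^sub>E S. (\<Prod>k\<in>S. A k (f k)) * half_det b S (\<lambda>k. B (f k)))"
  unfolding half_det_def rig_prod_sum_PiE[OF fin] sum_distrib_left prod.distrib
  by (rule sum.swap)

lemma half_det_mult_eq:
  fixes A B :: "'a \<Rightarrow> 'a \<Rightarrow> 'k::rig"
  assumes fin: "finite S" and zero: "\<And>p. p permutes S \<Longrightarrow> (\<Prod>k\<in>S. B k (p k)) = 0"
  shows "half_det True S (\<lambda>k c. \<Sum>l\<in>S. A k l * B l c) =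
    half_det False S (\<lambda>k c. \<Sum>l\<in>S. A k l * B l c)"
proof -
  have "half_det True S (\<lambda>k. B (f k)) = half_det False S (\<lambda>k. B (f k))"
    if f: "f \<in> S \<rightarrow>\<^sub>E S" for f
  proof (cases "inj_on f S")
    case True
    then show ?thesis
      using half_det_permuted_rows_eq_0[OF fin True _ zero] f by fastforce
  next
    case False
    then obtain x y where "x \<in> S" "y \<in> S" "x \<noteq> y" "f x = f y"
      by (auto simp: inj_on_def)
    then show ?thesis
      by (intro half_det_equal_rows[OF fin, of x y]) auto
  qed
  then show ?thesis
    by (simp add: half_det_mult[OF fin])
qed

text \<open>A permutation other than the identity moves at least two points, so it uses an off-diagonal
  entry outside the one exceptional column \<open>i\<close>.\<close>

lemma half_det_identity_but_column:
  fixes A :: "'a \<Rightarrow> 'a \<Rightarrow> 'k::rig"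
  assumes fin: "finite S" and i: "i \<in> S"
    and A: "\<And>k c. k \<in> S \<Longrightarrow> c \<in> S \<Longrightarrow> c \<noteq> i \<Longrightarrow> A k c = (if k = c then 1 else 0)"
  shows "half_det b S A = (if b then A i i else 0)"
proof -
  have zero: "(\<Prod>k\<in>S. A k (p k)) = 0" if p: "p permutes S" and "p \<noteq> id" for p
  proof -
    obtain x where x: "p x \<noteq> x"
      using \<open>p \<noteq> id\<close> by (auto simp: fun_eq_iff)
    obtain y where y: "p y \<noteq> y" "p y \<noteq> i"
    proof (cases "p x = i")
      case True
      \<comment> \<open>Then \<open>i\<close> is moved as well, and not to itself.\<close>
      then show ?thesis
        using x that[of i] permutes_inj[OF p] by (metis injD)
    qed (use x that in blast)
    have "y \<in> S"
      using y(1) p by (meson permutes_not_in)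
    then show ?thesis
      using A[of y "p y"] y p fin by (intro rig_prod_zero[of S y]) (auto simp: permutes_in_image)
  qed
  let ?P = "{p. p permutes S \<and> evenperm p = b}"
  have "half_det b S A = (\<Sum>p\<in>?P. if p = id then \<Prod>k\<in>S. A k k else 0)"
    unfolding half_det_def by (rule sum.cong) (auto simp: zero)
  also have "\<dots> = (if id \<in> ?P then \<Prod>k\<in>S. A k k else 0)"
    using finite_permutations[OF fin] by (subst sum.delta) auto
  also have "(\<Prod>k\<in>S. A k k) = A i i"
    using A i fin by (subst prod.remove[OF fin i]) (simp add: prod.neutral)
  finally show ?thesis
    using permutes_id[of S] by (simp add: id_def)
qed

section \<open>Paths inside permutations\<close>

text \<open>The orbit of \<open>i = p j\<close> comes back to \<open>j\<close>; the first return supplies the path. The steps before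
  it start at distinct points other than \<open>j\<close>, so the product along the path divides the product
  over \<open>S - {j}\<close>.\<close>

lemma permutes_path_prod_dvd:
  fixes A :: "'a \<Rightarrow> 'a \<Rightarrow> 'k::rig"
  assumes fin: "finite S" and p: "p permutes S" and j: "j \<in> S" and i: "p j = i"
  obtains q s where "s 0 = i" "s q = j" "\<And>m. s m \<in> S"
    "(\<Prod>m<q. A (s m) (s (Suc m))) dvd (\<Prod>k\<in>S - {j}. A k (p k))"
proof -
  define s where "s m = (p ^^ m) i" for m
  have "j \<in> orbit p j"
    using p fin by (intro permutation_self_in_orbit) (auto simp: permutation_permutes)
  then obtain m where "m > 0" "(p ^^ m) j = j"
    by (auto simp: orbit_altdef)
  then have "s (m - 1) = j"
    using i by (cases m) (auto simp: s_def funpow_swap1)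
  then have ex: "\<exists>q. s q = j" ..
  define q where "q = (LEAST q. s q = j)"
  have q: "s q = j"
    unfolding q_def by (rule LeastI_ex[OF ex])
  have first: "s m \<noteq> j" if "m < q" for m
    using that unfolding q_def by (rule not_less_Least)
  have inS: "s m \<in> S" for m
    by (induction m) (use i j p in \<open>auto simp: s_def permutes_in_image\<close>)
  have distinct: "s a \<noteq> s b" if "a < b" "b < q" for a b
  proof
    assume eq: "s a = s b"
    \<comment> \<open>Cutting the loop from \<open>a\<close> to \<open>b\<close> out of the path would give an earlier return to \<open>j\<close>.\<close>
    have "s (q - b + a) = (p ^^ (q - b)) (s a)"
      by (simp add: s_def funpow_add)
    also have "\<dots> = (p ^^ (q - b)) (s b)"
      by (simp add: eq)
    also have "\<dots> = (p ^^ (q - b + b)) i"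
      by (simp only: s_def funpow_add comp_apply)
    also have "\<dots> = j"
      using q that by (simp add: s_def)
    finally have "s (q - b + a) = j" .
    moreover have "q - b + a < q"
      using that by arith
    ultimately show False
      using first by blast
  qed
  have inj: "inj_on s {..<q}"
    by (rule linorder_inj_onI) (use distinct in auto)
  have sub: "s ` {..<q} \<subseteq> S - {j}"
    using inS first by auto
  have "(\<Prod>m<q. A (s m) (s (Suc m))) = (\<Prod>k\<in>s ` {..<q}. A k (p k))"
    unfolding prod.reindex[OF inj] by (simp add: s_def)
  moreover have "(\<Prod>k\<in>S - {j}. A k (p k)) =
      (\<Prod>k\<in>S - {j} - s ` {..<q}. A k (p k)) * (\<Prod>k\<in>s ` {..<q}. A k (p k))"
    by (rule prod.subset_diff[OF sub]) (use fin in simp)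
  ultimately have "(\<Prod>m<q. A (s m) (s (Suc m))) dvd (\<Prod>k\<in>S - {j}. A k (p k))"
    by (metis dvdI mult.commute)
  moreover have "s 0 = i"
    by (simp add: s_def)
  ultimately show thesis
    using that[of s q] q inS by blast
qed

lemma cramer_term_eq_0:
  fixes Z :: "'k::rig mat"
  assumes trans: "transitive_mat n Z" and ij: "i < n" "j < n" "Z $$ (i, j) = 0"
    and p: "p permutes {..<n}"
  shows "(\<Prod>k<n. if p k = i then (if k = j then 1 else 0) else Z $$ (k, p k)) = 0"
proof (cases "p j = i")
  case False
  obtain l where l: "p l = i"
    using permutes_surj[OF p] by (metis surjD)
  then have "l < n" "l \<noteq> j"
    using False ij permutes_in_image[OF p, of l] by auto
  with l show ?thesis
    by (intro rig_prod_zero[of _ l]) auto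
next
  case True
  obtain q s where s: "s 0 = i" "s q = j" "\<And>m. s m \<in> {..<n}"
    and dvd: "(\<Prod>m<q. Z $$ (s m, s (Suc m))) dvd (\<Prod>k\<in>{..<n} - {j}. Z $$ (k, p k))"
    by (rule permutes_path_prod_dvd[OF _ p _ True, of "\<lambda>a b. Z $$ (a, b)"]) (use ij in auto)
  have "(\<Prod>m<q. Z $$ (s m, s (Suc m))) = 0"
    using trans s ij unfolding transitive_mat_def by auto
  with dvd have zero: "(\<Prod>k\<in>{..<n} - {j}. Z $$ (k, p k)) = 0"
    by (auto elim: dvdE)
  have "p k \<noteq> i" if "k \<noteq> j" for k
    using that True permutes_inj[OF p] by (metis injD)
  then have "(\<Prod>k\<in>{..<n} - {j}. if p k = i then (if k = j then 1 else 0) else Z $$ (k, p k)) =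
      (\<Prod>k\<in>{..<n} - {j}. Z $$ (k, p k))"
    by (intro prod.cong) auto
  with zero True ij show ?thesis
    by (subst prod.remove[of _ j]) auto
qed

section \<open>Vanishing entries of the inverse\<close>

theorem theoremA4:
  fixes Z :: "'k::rig mat" and n i j :: nat
  assumes "Z \<in> carrier_mat n n"
    and "rig_invertible_mat n Z"
    and "transitive_mat n Z"
    and "i < n" and "j < n"
  shows "Z $$ (i, j) = 0 \<Longrightarrow> rig_inverse_mat n Z $$ (i, j) = 0"
proof -
  assume Zij: "Z $$ (i, j) = 0"
  define W where "W = rig_inverse_mat n Z"
  have W: "W \<in> carrier_mat n n" and WZ: "W * Z = 1\<^sub>m n"
    using is_inverse_rig_inverse_mat[OF assms(2)] by (auto simp: is_inverse_mat_def W_def)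
  define M where "M k c = (if c = i then (if k = j then 1 else 0) else Z $$ (k, c))" for k c
  define N where "N k c = (\<Sum>l<n. W $$ (k, l) * M l c)" for k c
  have "half_det True {..<n} N = half_det False {..<n} N"
    unfolding N_def
    by (rule half_det_mult_eq) (use cramer_term_eq_0[OF assms(3-5) Zij] in \<open>auto simp: M_def\<close>)
  moreover have "N k c = (if k = c then 1 else 0)" if "k < n" "c < n" "c \<noteq> i" for k c
  proof -
    have "N k c = (W * Z) $$ (k, c)"
      using that W assms(1) by (simp add: N_def M_def scalar_prod_def lessThan_atLeast0)
    then show ?thesis
      using that by (simp add: WZ)
  qed
  then have "half_det b {..<n} N = (if b then N i i else 0)" for b
    using assms(4) by (intro half_det_identity_but_column) auto
  moreover have "N i i = W $$ (i, j)"
  proof -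
    have "N i i = (\<Sum>l<n. if l = j then W $$ (i, l) else 0)"
      unfolding N_def M_def by (rule sum.cong) auto
    then show ?thesis
      using assms(5) by simp
  qed
  ultimately show "rig_inverse_mat n Z $$ (i, j) = 0"
    by (simp add: W_def)
qed

end
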